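(* Let $G$ be a mock threshold graph. Then the Total Coloring Conjecture holds for $G$; that is, the total chromatic number satisfies $\chi''(G)\in\{\Delta(G)+1,\Delta(G)+2\}$.
   Context: Graphs are finite and simple. $\Delta(G)$ denotes the maximum degree of $G$. A total coloring of $G$ is an assignment of colors to the vertices and edges of $G$ such that no two adjacent or incident elements receive the same color (adjacent vertices get different colors, distinct edges sharing an endpoint get different colors, and each edge gets a color different from those of its two endpoints). The total chromatic number $\chi''(G)$ is the least number of colors in a total coloring of $G$. A graph $G$ is mock threshold if there is an ordering $v_1,\dots,v_n$ of its vertices such that for every $i$ with $1\le i\le n$ the degree of $v_i$ in the subgraph of $G$ induced by $\{v_1,\dots,v_i\}$ is $0$, $1$, $i-2$, or $i-1$. *)

theory Defs
  imports "HOL-Library.Ramsey"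
begin

text \<open>A finite simple graph is a finite vertex set \<open>V\<close> together with a set \<open>E\<close> of
  two-element subsets of \<open>V\<close>.\<close>

definition simple_graph :: "'a set \<Rightarrow> 'a set set \<Rightarrow> bool" where
  "simple_graph V E \<longleftrightarrow> finite V \<and> E \<subseteq> nsets V 2"

definition degree :: "'a set set \<Rightarrow> 'a \<Rightarrow> nat" where
  "degree E v = card {e \<in> E. v \<in> e}"

definition max_degree :: "'a set \<Rightarrow> 'a set set \<Rightarrow> nat" where
  "max_degree V E = Max (degree E ` V)"

definition induced_edges :: "'a set set \<Rightarrow> 'a set \<Rightarrow> 'a set set" where
  "induced_edges E W = {e \<in> E. e \<subseteq> W}"

text \<open>In \<open>mock_threshold\<close> the index \<open>i\<close> is 1-based, as in an ordering
  \<open>v\<^sub>1, \<dots>, v\<^sub>n\<close>, so \<open>v\<^sub>i\<close> is \<open>vs ! (i - 1)\<close>. Degrees \<open>i - 2\<close> and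
  \<open>i - 1\<close> are written additively to avoid truncated subtraction.\<close>

definition mock_threshold :: "'a set \<Rightarrow> 'a set set \<Rightarrow> bool" where
  "mock_threshold V E \<longleftrightarrow>
     (\<exists>vs. distinct vs \<and> set vs = V \<and>
        (\<forall>i\<in>{1..length vs}.
           let d = degree (induced_edges E (set (take i vs))) (vs ! (i - 1))
           in d = 0 \<or> d = 1 \<or> d + 2 = i \<or> d + 1 = i))"

text \<open>A total coloring colors the disjoint union of vertices (\<open>Inl\<close>) and edges (\<open>Inr\<close>).
  Values outside \<open>V <+> E\<close> are irrelevant.\<close>

definition total_coloring :: "'a set \<Rightarrow> 'a set set \<Rightarrow> ('a + 'a set \<Rightarrow> 'c) \<Rightarrow> bool" where
  "total_coloring V E c \<longleftrightarrow>
     (\<forall>u\<in>V. \<forall>v\<in>V. {u, v} \<in> E \<longrightarrow> c (Inl u) \<noteq> c (Inl v)) \<and>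
     (\<forall>e\<in>E. \<forall>f\<in>E. e \<noteq> f \<longrightarrow> e \<inter> f \<noteq> {} \<longrightarrow> c (Inr e) \<noteq> c (Inr f)) \<and>
     (\<forall>v\<in>V. \<forall>e\<in>E. v \<in> e \<longrightarrow> c (Inl v) \<noteq> c (Inr e))"

definition total_chromatic_number :: "'a set \<Rightarrow> 'a set set \<Rightarrow> nat" where
  "total_chromatic_number V E =
     (LEAST k. \<exists>c :: 'a + 'a set \<Rightarrow> nat. total_coloring V E c \<and> c ` (V <+> E) \<subseteq> {..<k})"

text \<open>The minimum in \<open>total_chromatic_number\<close> is over a nonempty set.\<close>

lemma total_coloring_exists:
  assumes "simple_graph V E"
  shows "\<exists>k. \<exists>c :: 'a + 'a set \<Rightarrow> nat. total_coloring V E c \<and> c ` (V <+> E) \<subseteq> {..<k}"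
proof -
  have fV: "finite V" and E: "E \<subseteq> nsets V 2"
    using assms by (auto simp: simple_graph_def)
  have "E \<subseteq> Pow V"
    using E by (auto simp: nsets_def)
  then have "finite (V <+> E)"
    using fV by (simp add: finite_subset)
  then obtain c :: "'a + 'a set \<Rightarrow> nat" and n where
    c: "c ` (V <+> E) = {i. i < n}" "inj_on c (V <+> E)"
    by (metis finite_imp_inj_to_nat_seg)
  have inj: "c x \<noteq> c y" if "x \<in> V <+> E" "y \<in> V <+> E" "x \<noteq> y" for x y
    using c(2) that unfolding inj_on_def by blast
  have ne: "u \<noteq> v" if "{u, v} \<in> E" for u v
  proof -
    have "card {u, v} = 2"
      using that E by (auto simp: nsets_def)
    then show ?thesis by (cases "u = v") simp_all
  qed
  have "total_coloring V E c"
    unfolding total_coloring_def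
    by (intro conjI ballI impI inj InlI InrI) (simp_all add: ne)
  moreover have "c ` (V <+> E) \<subseteq> {..<n}"
    using c(1) by auto
  ultimately show ?thesis by blast
qed

end

theory Submission
  imports Defs
begin

text \<open>Build the graph vertex by vertex. An isolated or pendant vertex is added greedily with
  \<open>\<Delta> + 2\<close> colors. If a vertex is added with degree \<open>n - 2\<close> or \<open>n - 1\<close>, where \<open>n\<close> is the current
  order, the graph is colored from scratch.
  For odd \<open>N\<close>, labelling at most \<open>N\<close> vertices by distinct residues mod \<open>N\<close> and giving edge \<open>ij\<close> color \<open>i + j\<close>
  and vertex \<open>i\<close> color \<open>2i\<close> is a total coloring; this suffices unless \<open>n\<close> is even and
  \<open>\<Delta> = n - 2\<close>.
  In that case every vertex has a non-neighbour, so the complement contains a spanning forest of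
  nontrivial stars. One leaf becomes the point \<open>\<infinity>\<close>, the other vertices are labelled by the residues
  mod \<open>N = n - 1\<close>; edge \<open>ij\<close> gets color \<open>i + j\<close> and edge \<open>\<infinity>i\<close> gets color \<open>2i\<close>. The missing edge from a
  leaf \<open>l\<close> to its centre \<open>c\<close> frees color \<open>l + c\<close> at both ends. Labelling the centres first and then
  the leaves star by star makes these freed colors pairwise distinct, so they can be used on the
  vertices; the extra color \<open>N\<close> serves \<open>\<infinity>\<close> and, if it lost its only leaf, the centre of \<open>\<infinity>\<close>.\<close>

section \<open>Total colorings as pairs of functions\<close>

text \<open>\<open>p\<close> colors vertices and \<open>q\<close> colors edges through ordered pairs
  of endpoints, which suits formulas such as \<open>g x + g y\<close>. Since
  \<open>{x, y} = {y, x}\<close>, quantifying over ordered pairs imposes each condition at both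
  endpoints; off the edges \<open>q\<close> is arbitrary.\<close>

definition total_colorable :: "'a set \<Rightarrow> 'a set set \<Rightarrow> nat \<Rightarrow> bool" where
  "total_colorable V E k \<longleftrightarrow>
     (\<exists>(p :: 'a \<Rightarrow> nat) q. (\<forall>x\<in>V. p x < k) \<and>
        (\<forall>x y. {x, y} \<in> E \<longrightarrow> q x y = q y x \<and> q x y < k \<and> p x \<noteq> p y \<and> p x \<noteq> q x y \<and>
           (\<forall>z. {x, z} \<in> E \<longrightarrow> y \<noteq> z \<longrightarrow> q x y \<noteq> q x z)))"

lemma total_colorable_mono:
  fixes V :: "'a set"
  assumes "total_colorable V E k" "k \<le> l"
  shows "total_colorable V E l"
proof -
  have "n < l" if "n < k" for n using that assms(2) by simp
  moreover obtain p :: "'a \<Rightarrow> nat" and q where "\<forall>x\<in>V. p x < k"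
    "\<forall>x y. {x, y} \<in> E \<longrightarrow> q x y = q y x \<and> q x y < k \<and> p x \<noteq> p y \<and> p x \<noteq> q x y \<and>
      (\<forall>z. {x, z} \<in> E \<longrightarrow> y \<noteq> z \<longrightarrow> q x y \<noteq> q x z)"
    using assms(1) unfolding total_colorable_def by blast
  ultimately show ?thesis
    unfolding total_colorable_def by (intro exI[of _ p] exI[of _ q] conjI ballI allI impI) blast+
qed

lemma edge_props:
  assumes "E \<subseteq> nsets V 2" "{x, y} \<in> E"
  shows "x \<in> V" "y \<in> V" "x \<noteq> y"
proof -
  have "{x, y} \<in> nsets V 2" using assms by blast
  then show "x \<in> V" "y \<in> V" "x \<noteq> y"
    by (auto simp: nsets_def card_insert_if split: if_splits)
qed

lemma edge_obtain:
  assumes "E \<subseteq> nsets V 2" "e \<in> E"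
  obtains x y where "e = {x, y}"
  using assms by (auto simp: nsets_def card_2_iff)

lemma total_colorable_imp_coloring:
  fixes V :: "'a set"
  assumes E: "E \<subseteq> nsets V 2" and "total_colorable V E k"
  shows "\<exists>c :: 'a + 'a set \<Rightarrow> nat. total_coloring V E c \<and> c ` (V <+> E) \<subseteq> {..<k}"
proof -
  obtain p :: "'a \<Rightarrow> nat" and q where pk: "\<And>x. x \<in> V \<Longrightarrow> p x < k"
    and q: "\<And>x y. {x, y} \<in> E \<Longrightarrow> q x y = q y x \<and> q x y < k \<and> p x \<noteq> p y \<and> p x \<noteq> q x y"
    and qz: "\<And>x y z. {x, y} \<in> E \<Longrightarrow> {x, z} \<in> E \<Longrightarrow> y \<noteq> z \<Longrightarrow> q x y \<noteq> q x z"
    using assms(2) unfolding total_colorable_def by blast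
  \<comment> \<open>Symmetry of \<open>q\<close> on edges makes the chosen order of the endpoints
    immaterial.\<close>
  define r where "r e = (SOME k. \<exists>x y. e = {x, y} \<and> k = q x y)" for e
  have r: "r {x, y} = q x y" if "{x, y} \<in> E" for x y
    unfolding r_def by (rule some1_equality) (use q[OF that] in \<open>auto simp: doubleton_eq_iff\<close>)
  define c where "c = case_sum p r"
  have 1: "r e \<noteq> r f" if ef: "e \<in> E" "f \<in> E" "e \<noteq> f" "e \<inter> f \<noteq> {}" for e f
  proof -
    obtain x where x: "x \<in> e" "x \<in> f" using ef by blast
    obtain y where y: "e = {x, y}" using edge_obtain[OF E ef(1)] x by auto
    obtain z where z: "f = {x, z}" using edge_obtain[OF E ef(2)] x by auto
    show ?thesis using r qz ef y z by metis
  qed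
  have 2: "p v \<noteq> r e" if e: "e \<in> E" "v \<in> e" for v e
  proof -
    obtain y where "e = {v, y}" using edge_obtain[OF E e(1)] e(2) by auto
    then show ?thesis using r q e by metis
  qed
  have 3: "r e < k" if "e \<in> E" for e
    using edge_obtain[OF E that] r q that by metis
  have "total_coloring V E c"
    unfolding total_coloring_def c_def using q 1 2 by auto
  moreover have "c ` (V <+> E) \<subseteq> {..<k}"
    unfolding c_def using pk 3 by auto
  ultimately show ?thesis by blast
qed

section \<open>Cyclic colorings modulo an odd number\<close>

lemma mod_add_left_cancel_nat:
  fixes a b c N :: nat
  assumes "(a + b) mod N = (a + c) mod N" "b < N" "c < N"
  shows "b = c"
proof -
  have "int b mod int N = int c mod int N"
    using assms(1) by (metis add_diff_cancel_left' mod_diff_left_eq of_nat_add zmod_int)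
  then show ?thesis using assms by (simp flip: zmod_int)
qed

text \<open>2 is a unit modulo an odd \<open>N\<close>.\<close>

lemma mod_double_cancel_nat:
  fixes b c N :: nat
  assumes "(2 * b) mod N = (2 * c) mod N" "b < N" "c < N" "odd N"
  shows "b = c"
proof -
  have "int N dvd 2 * (int b - int c)"
    using assms(1) by (metis mod_eq_dvd_iff of_nat_mult of_nat_numeral right_diff_distrib zmod_int)
  moreover have "coprime (int N) 2" using assms(4) by simp
  ultimately have "int N dvd int b - int c" by (metis coprime_dvd_mult_right_iff)
  then show ?thesis using assms(2,3) by (metis mod_eq_dvd_iff mod_less of_nat_eq_iff zmod_int)
qed

text \<open>A vertex is colored like a loop at itself, so vertex-edge and edge-edge conflicts are
  both excluded by cancelling \<open>g x\<close>. Only vertex-vertex conflicts need \<open>N\<close>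
  to be odd.\<close>

lemma total_colorable_odd:
  assumes E: "E \<subseteq> nsets V 2" and fin: "finite V" and N: "odd N" "card V \<le> N"
  shows "total_colorable V E N"
proof -
  obtain g where g: "inj_on g V" "g ` V \<subseteq> {..<N}"
    using card_le_inj[of V "{..<N}"] fin N by auto
  have N0: "N > 0" using N by (auto intro: Nat.gr0I)
  have gN: "g x < N" if "x \<in> V" for x using g that by auto
  have gi: "g x \<noteq> g y" if "{x, y} \<in> E" for x y
    using edge_props[OF E that] g by (auto dest: inj_onD)
  show ?thesis
    unfolding total_colorable_def
  proof (intro exI[of _ "\<lambda>x. (2 * g x) mod N"] exI[of _ "\<lambda>x y. (g x + g y) mod N"] conjI ballI allI impI)
    fix x y assume xy: "{x, y} \<in> E"
    note V = edge_props[OF E xy]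
    show "2 * g x mod N \<noteq> 2 * g y mod N"
      using mod_double_cancel_nat gN V gi[OF xy] N by metis
    show "2 * g x mod N \<noteq> (g x + g y) mod N"
      using mod_add_left_cancel_nat[of "g x" "g x"] gN V gi[OF xy] by (metis mult_2)
    fix z assume xz: "{x, z} \<in> E" "y \<noteq> z"
    show "(g x + g y) mod N \<noteq> (g x + g z) mod N"
      using mod_add_left_cancel_nat[of "g x"] gN V edge_props[OF E xz(1)] xz(2) g
      by (meson inj_onD)
  qed (use N0 in \<open>auto simp: add.commute\<close>)
qed

section \<open>Spanning forests of nontrivial stars\<close>

lemma spanning_star_forest:
  assumes fin: "finite V" and sym: "\<And>x y. R x y \<Longrightarrow> R y x" and irr: "\<And>x. \<not> R x x"
    and ex: "\<And>v. v \<in> V \<Longrightarrow> \<exists>u\<in>V. R v u"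
  obtains L f where "L \<subseteq> V" "f ` L = V - L" "\<And>l. l \<in> L \<Longrightarrow> R l (f l)"
proof -
  \<comment> \<open>Stars grow greedily; in the last case below a star consisting of one edge is reversed.\<close>
  have "\<exists>S L f. A \<subseteq> S \<and> S \<subseteq> V \<and> L \<subseteq> S \<and> f ` L = S - L \<and> (\<forall>l\<in>L. R l (f l))" if "finite A" "A \<subseteq> V" for A
    using that
  proof (induction A)
    case empty
    show ?case by (intro exI[of _ "{}"]) auto
  next
    case (insert v A)
    then obtain S L f where S: "A \<subseteq> S" "S \<subseteq> V" "L \<subseteq> S" "f ` L = S - L" "\<forall>l\<in>L. R l (f l)"
      by auto
    obtain u where u: "u \<in> V" "R v u" using ex insert.prems by blast
    have uv: "u \<noteq> v" using u irr by blast
    show ?case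
    proof (cases "v \<in> S")
      case True
      then show ?thesis using S by (intro exI[of _ S] exI[of _ L] exI[of _ f]) auto
    next
      case v: False
      then have vL: "v \<notin> L" using S by blast
      have ext: ?thesis if "insert v S \<subseteq> S'" "S' \<subseteq> V" "L' \<subseteq> S'" "f' ` L' = S' - L'"
        "\<forall>l\<in>L'. R l (f' l)" for S' L' f'
        using that S(1) by (intro exI[of _ S'] exI[of _ L'] exI[of _ f']) auto
      have im: "f(v := u) ` insert v B = insert u (f ` B)" if "v \<notin> B" for B
        using that by (auto simp: fun_upd_image)
      have S': "insert v S \<subseteq> V" using S(2) insert.prems by simp
      \<comment> \<open>If \<open>u\<close> is not a leaf, \<open>v\<close> is hung on it; a
        \<open>u\<close> outside \<open>S\<close> enters as a new centre, which is why
        \<open>S\<close> may exceed \<open>A\<close>. If \<open>u\<close> is a leaf whose centre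
        keeps another leaf, \<open>u\<close> is detached and becomes the centre of \<open>v\<close>.
        Otherwise \<open>u\<close> is the only leaf of its centre, and becomes the centre of both
        \<open>v\<close> and its old centre.\<close>
      consider "u \<notin> L" | "u \<in> L" "f u \<in> f ` (L - {u})" | "u \<in> L" "f u \<notin> f ` (L - {u})"
        by blast
      then show ?thesis
      proof cases
        case 1
        show ?thesis
        proof (rule ext)
          show "f(v := u) ` insert v L = insert v (insert u S) - insert v L"
            unfolding im[OF vL] S(4) using 1 v uv by blast
          show "\<forall>l\<in>insert v L. R l ((f(v := u)) l)" using S(5) u(2) by simp
        qed (use S(3) S' u(1) in blast)+
      next
        case 2
        have *: "f ` (L - {u}) = S - L"
        proof -
          have "f ` L = insert (f u) (f ` (L - {u}))" using 2(1) by blast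
          then show ?thesis using 2(2) S(4) by (simp add: insert_absorb)
        qed
        have vL': "v \<notin> L - {u}" using vL by blast
        show ?thesis
        proof (rule ext)
          show "f(v := u) ` insert v (L - {u}) = insert v S - insert v (L - {u})"
            unfolding im[OF vL'] * using 2(1) S(3) v uv by blast
          show "\<forall>l\<in>insert v (L - {u}). R l ((f(v := u)) l)" using S(5) u(2) by simp
        qed (use S(3) S' u(1) in blast)+
      next
        case 3
        define c where "c = f u"
        have c: "c \<in> S" "c \<notin> L" using S(4) 3(1) by (auto simp: c_def)
        have cuv: "u \<noteq> c" "v \<noteq> c" using c 3(1) v by auto
        have "f ` L = insert c (f ` (L - {u}))" using 3(1) by (auto simp: c_def)
        then have *: "f ` (L - {u}) = S - L - {c}" using 3(2) S(4) by (simp add: c_def)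
        let ?f = "f(v := u, c := u)"
        have "?f ` (L - {u}) = f ` (L - {u})"
          by (rule image_cong) (use vL c in auto)
        moreover have "?f v = u" "?f c = u" using cuv by simp_all
        ultimately have im': "?f ` insert v (insert c (L - {u})) = insert u (S - L - {c})"
          by (simp only: image_insert * insert_absorb2)
        show ?thesis
        proof (rule ext)
          show "?f ` insert v (insert c (L - {u})) = insert v S - insert v (insert c (L - {u}))"
            unfolding im' using 3(1) S(3) c v uv cuv by auto
          show "\<forall>l\<in>insert v (insert c (L - {u})). R l (?f l)"
            using S(5) u(2) 3(1) sym by (simp add: c_def)
        qed (use S(3) S' c in blast)+
      qed
    qed
  qed
  from this[OF fin order_refl] obtain S L f where S: "V \<subseteq> S" "S \<subseteq> V" "L \<subseteq> S" "f ` L = S - L"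
    and f: "\<forall>l\<in>L. R l (f l)" by (elim exE conjE)
  have "S = V" using S(1,2) by (rule subset_antisym[rotated])
  show ?thesis
    by (rule that[of L f]) (use S(3,4) f \<open>S = V\<close> in simp_all)
qed

section \<open>The coloring for even order without a universal vertex\<close>

text \<open>Positions in a list sorted by \<open>h\<close> serve as labels. With \<open>h\<close>
  the label of the centre this lists leaves star by star; a constant \<open>h\<close> gives a plain
  enumeration.\<close>

lemma finite_enum_refining:
  fixes h :: "'a \<Rightarrow> nat"
  assumes "finite A"
  obtains g where "bij_betw g A {..<card A}" "\<And>x y. x \<in> A \<Longrightarrow> y \<in> A \<Longrightarrow> h x < h y \<Longrightarrow> g x < g y"
proof -
  obtain xs0 where xs0: "set xs0 = A" "distinct xs0" using assms finite_distinct_list by blast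
  define xs where "xs = sort_key h xs0"
  have xs: "set xs = A" "distinct xs" "sorted (map h xs)" "length xs = card A"
    unfolding xs_def using xs0 by (auto simp: distinct_card)
  have bij: "bij_betw ((!) xs) {..<card A} A" using bij_betw_nth[OF xs(2)] xs by simp
  define g where "g = inv_into {..<card A} ((!) xs)"
  have g: "bij_betw g A {..<card A}" unfolding g_def by (rule bij_betw_inv_into[OF bij])
  have nth: "xs ! g x = x" "g x < length xs" if "x \<in> A" for x
    using that bij g xs(4) unfolding g_def by (auto simp: bij_betw_inv_into_right bij_betw_apply dest: bij_betwE)
  show ?thesis
  proof (rule that[OF g])
    fix x y assume "x \<in> A" "y \<in> A" "h x < h y"
    then show "g x < g y"
      using sorted_nth_mono[OF xs(3), of "g y" "g x"] nth by (fastforce simp: not_less[symmetric])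
  qed
qed

text \<open>On the complete graph the edge coloring would use all \<open>N\<close> residues at every
  vertex, so below \<open>N\<close> a vertex can only take a color released by a missing
  edge.\<close>

lemma total_colorable_even:
  fixes V :: "'a set"
  assumes E: "E \<subseteq> nsets V 2" and fin: "finite V" and even: "even (card V)" and ne: "V \<noteq> {}"
    and ex: "\<And>v. v \<in> V \<Longrightarrow> \<exists>u\<in>V. v \<noteq> u \<and> {v, u} \<notin> E"
  shows "total_colorable V E (card V)"
proof -
  obtain L f where L: "L \<subseteq> V" "f ` L = V - L" and Lf: "\<And>l. l \<in> L \<Longrightarrow> l \<noteq> f l \<and> {l, f l} \<notin> E"
    using spanning_star_forest[of V "\<lambda>u v. u \<noteq> v \<and> {u, v} \<notin> E"] fin ex
    by (auto simp: insert_commute)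
  obtain l0 where l0: "l0 \<in> L" using L ne by blast
  define L' D N where "L' = L - {l0}" and "D = V - L" and "N = card V - 1"
  have cV: "card V > 0" using fin ne by (simp add: card_gt_0_iff)
  then have N: "odd N" "card V = Suc N" using even by (auto simp: N_def)
  then have N0: "N > 0" by (auto intro: Nat.gr0I)
  have finLD: "finite L'" "finite D" using fin L by (auto simp: L'_def D_def intro: finite_subset)
  have "card V = card L + card D"
    using L fin by (metis D_def card_Diff_subset card_mono finite_subset le_add_diff_inverse)
  moreover have "card L = Suc (card L')"
    unfolding L'_def using l0 fin L by (metis card.remove finite_subset)
  ultimately have cN: "N = card L' + card D" using N by simp
  obtain g1 where g1: "bij_betw g1 D {..<card D}"
    using finite_enum_refining[OF finLD(2), of "\<lambda>_. 0"] by blast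
  \<comment> \<open>Along this order of the leaves the labels of the centres never decrease.\<close>
  obtain g2 where g2: "bij_betw g2 L' {..<card L'}"
    and g2m: "\<And>x y. x \<in> L' \<Longrightarrow> y \<in> L' \<Longrightarrow> g1 (f x) < g1 (f y) \<Longrightarrow> g2 x < g2 y"
    using finite_enum_refining[OF finLD(1), of "\<lambda>x. g1 (f x)"] by blast
  \<comment> \<open>\<open>l0\<close> is the point at infinity; its value under \<open>g\<close> is
    arbitrary and enters no color of an edge.\<close>
  define g where "g x = (if x \<in> D then g1 x else card D + g2 x)" for x
  have g1D: "g1 x < card D" if "x \<in> D" for x using g1 that by (auto dest: bij_betwE)
  have g2L: "g2 x < card L'" if "x \<in> L'" for x using g2 that by (auto dest: bij_betwE)
  have VLD: "x \<in> L' \<and> x \<notin> D \<or> x \<in> D \<and> x \<notin> L'" if "x \<in> V" "x \<noteq> l0" for x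
    using that by (auto simp: L'_def D_def)
  have gN: "g x < N" if "x \<in> V" "x \<noteq> l0" for x
    using VLD[OF that] g1D[of x] g2L[of x] cN by (auto simp: g_def)
  have ginj: "x = y" if "g x = g y" "x \<in> V" "x \<noteq> l0" "y \<in> V" "y \<noteq> l0" for x y
    using VLD[OF that(2,3)] VLD[OF that(4,5)] that(1) g1D[of x] g1D[of y]
      bij_betw_imp_inj_on[OF g1] bij_betw_imp_inj_on[OF g2]
    by (auto simp: g_def dest: inj_onD)
  have fD: "f l \<in> D" if "l \<in> L'" for l using that L by (auto simp: L'_def D_def)
  have LD: "l \<notin> D" if "l \<in> L'" for l using that by (auto simp: L'_def D_def)
  define s where "s l = (g l + g (f l)) mod N" for l
  \<comment> \<open>The integers \<open>g l + g (f l)\<close> strictly increase along the leaves.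
    Two of them differ by at most \<open>(card L' - 1) + (card D - 1)\<close>, which is less than
    \<open>N\<close>, so they stay distinct modulo \<open>N\<close>.\<close>
  have s_less: "s l \<noteq> s l'" if l: "l \<in> L'" "l' \<in> L'" "g2 l < g2 l'" for l l'
  proof
    assume "s l = s l'"
    moreover have "g1 (f l) \<le> g1 (f l')" using g2m[of l' l] l by linarith
    moreover have "g l = card D + g2 l" "g l' = card D + g2 l'" "g (f l) = g1 (f l)" "g (f l') = g1 (f l')"
      using l fD LD by (auto simp: g_def)
    ultimately have "(g l + g (f l)) mod N = (g l' + g (f l')) mod N" "g l + g (f l) < g l' + g (f l')"
      "g l' + g (f l') - (g l + g (f l)) < N"
      unfolding s_def using l(3) g2L[OF l(2)] g1D[OF fD[OF l(2)]] cN by linarith+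
    then have "N dvd g l' + g (f l') - (g l + g (f l))" "0 < g l' + g (f l') - (g l + g (f l))"
      by (simp_all add: mod_eq_dvd_iff_nat[symmetric])
    then show False
      using \<open>g l' + g (f l') - (g l + g (f l)) < N\<close> by (meson dvd_imp_le not_less)
  qed
  have s_inj: "l = l'" if "l \<in> L'" "l' \<in> L'" "s l = s l'" for l l'
    using s_less[of l l'] s_less[of l' l] that bij_betw_imp_inj_on[OF g2]
    by (metis inj_onD linorder_neqE_nat)
  \<comment> \<open>\<open>b x\<close> is the leaf whose star edge is incident with \<open>x\<close> and provides the color of \<open>x\<close>.\<close>
  define b where "b x = (if x \<in> L' then x else inv_into L' f x)" for x
  define p where "p x = (if x \<in> L' \<union> f ` L' then s (b x) else N)" for x
  define q where "q x y = (if x = l0 then 2 * g y else if y = l0 then 2 * g x else g x + g y) mod N" for x y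
  have b: "b x \<in> L' \<and> (x = b x \<or> x = f (b x))" if "x \<in> L' \<union> f ` L'" for x
    using that by (auto simp: b_def inv_into_into f_inv_into_f)
  \<comment> \<open>Besides \<open>l0\<close>, only its centre can lack a remaining leaf. These two
    are not adjacent, so both may take the extra color \<open>N\<close>.\<close>
  have notb: "x = l0 \<or> x = f l0" if "x \<in> V" "x \<notin> L' \<union> f ` L'" for x
    using that L by (auto simp: L'_def)
  have qN: "q x y < N" for x y using N0 by (simp add: q_def)
  have sN: "s l < N" for l using N0 by (simp add: s_def)
  have nonadj: "{x, y} \<notin> E" if "x \<in> {l, f l}" "y \<in> {l, f l}" "l \<in> L" for x y l
    using that Lf[of l] edge_props(3)[OF E, of x y] by (auto simp: insert_commute)
  have L'L: "l \<in> L" if "l \<in> L'" for l using that by (simp add: L'_def)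
  have pp: "p x \<noteq> p y" if xy: "{x, y} \<in> E" for x y
  proof
    note V = edge_props[OF E xy]
    assume eq: "p x = p y"
    show False
    proof (cases "x \<in> L' \<union> f ` L'")
      case True
      then have y: "y \<in> L' \<union> f ` L'" using eq sN[of "b x"] by (auto simp: p_def split: if_splits)
      \<comment> \<open>Equal colors below \<open>N\<close> come from one leaf, so both vertices lie
        on the same missing star edge.\<close>
      then have "b x = b y" using eq True b[OF True] b[OF y] s_inj by (simp add: p_def)
      then show False using nonadj[of x "b x" y] b[OF True] b[OF y] xy L'L by auto
    next
      case False
      then have y: "y \<notin> L' \<union> f ` L'" using eq sN[of "b y"] by (auto simp: p_def split: if_splits)
      show False using nonadj[of x l0 y] notb[OF V(1) False] notb[OF V(2) y] xy l0 by auto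
    qed
  qed
  have pq: "p x \<noteq> q x y" if xy: "{x, y} \<in> E" for x y
  proof
    note V = edge_props[OF E xy]
    assume eq: "p x = q x y"
    then have x: "x \<in> L' \<union> f ` L'" using qN[of x y] by (auto simp: p_def split: if_splits)
    define l where "l = b x"
    \<comment> \<open>The other end of the missing edge whose color \<open>x\<close>
      received.\<close>
    define x' where "x' = (if x = l then f l else l)"
    have l: "l \<in> L'" "x = l \<or> x = f l" using b[OF x] by (auto simp: l_def)
    have x0: "x \<noteq> l0" using x l0 L by (auto simp: L'_def)
    have x': "x' \<in> V" "x' \<noteq> l0" "x' \<noteq> x"
      using l L l0 Lf[of l] by (auto simp: x'_def L'_def)
    have "s l = (g x + g x') mod N" using l by (auto simp: s_def x'_def add.commute)
    \<comment> \<open>An edge from \<open>x\<close> to \<open>l0\<close> has color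
      \<open>g x + g x\<close>, so reading \<open>l0\<close> as \<open>x\<close> itself gives all
      edges at \<open>x\<close> one formula, to which cancellation applies.\<close>
    then have "(g x + g x') mod N = (g x + g (if y = l0 then x else y)) mod N"
      using eq x x0 by (auto simp: p_def q_def l_def mult_2)
    then have "g x' = g (if y = l0 then x else y)"
      by (rule mod_add_left_cancel_nat) (use gN V x' x0 in auto)
    then have "x' = (if y = l0 then x else y)"
      by (rule ginj) (use V x' x0 in auto)
    then have "x' = y" using x' by (auto split: if_splits)
    then show False using nonadj[of x l y] l xy L'L by (auto simp: x'_def split: if_splits)
  qed
  have qq: "q x y \<noteq> q x z" if xy: "{x, y} \<in> E" and xz: "{x, z} \<in> E" and yz: "y \<noteq> z" for x y z
  proof
    note V = edge_props[OF E xy] edge_props[OF E xz]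
    assume eq: "q x y = q x z"
    show False
    proof (cases "x = l0")
      case True
      then have "g y = g z"
        using eq mod_double_cancel_nat[of "g y" N "g z"] gN V N by (auto simp: q_def)
      then show False using ginj V yz True by blast
    next
      case False
      have "(g x + g (if y = l0 then x else y)) mod N = (g x + g (if z = l0 then x else z)) mod N"
        using eq False by (simp add: q_def mult_2 split: if_splits)
      then have "g (if y = l0 then x else y) = g (if z = l0 then x else z)"
        by (rule mod_add_left_cancel_nat) (use gN V False in auto)
      then have "(if y = l0 then x else y) = (if z = l0 then x else z)"
        by (rule ginj) (use V False in auto)
      then show False using V yz by (auto split: if_splits)
    qed
  qed
  have "q x y = q y x" for x y by (simp add: q_def add.commute)
  moreover have "p x < Suc N" for x using sN[of "b x"] by (auto simp: p_def)
  ultimately show ?thesis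
    unfolding total_colorable_def N(2) using pp pq qq qN
    by (intro exI[of _ p] exI[of _ q]) (auto intro: less_SucI)
qed

section \<open>Adding one vertex\<close>

lemma induced_edges_subset_nsets:
  "E \<subseteq> nsets V 2 \<Longrightarrow> induced_edges E W \<subseteq> nsets W 2"
  by (auto simp: induced_edges_def nsets_def)

lemma degree_eq_card_neighbours:
  assumes E: "E \<subseteq> nsets V 2" and fin: "finite V"
  shows "degree E v = card {u \<in> V. {v, u} \<in> E}"
proof -
  have "bij_betw (\<lambda>u. {v, u}) {u \<in> V. {v, u} \<in> E} {e \<in> E. v \<in> e}"
    unfolding bij_betw_def
  proof
    show "inj_on (\<lambda>u. {v, u}) {u \<in> V. {v, u} \<in> E}" by (auto simp: inj_on_def doubleton_eq_iff)
    show "(\<lambda>u. {v, u}) ` {u \<in> V. {v, u} \<in> E} = {e \<in> E. v \<in> e}"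
    proof (intro set_eqI iffI)
      fix e assume e: "e \<in> {e \<in> E. v \<in> e}"
      then obtain u where "e = {v, u}" using edge_obtain[OF E, of e] by auto
      then show "e \<in> (\<lambda>u. {v, u}) ` {u \<in> V. {v, u} \<in> E}" using e edge_props[OF E] by auto
    qed auto
  qed
  then show ?thesis unfolding degree_def by (rule bij_betw_same_card[symmetric])
qed

text \<open>With \<open>n = card V\<close>, odd \<open>n\<close> needs only \<open>n\<close> colors,
  and even \<open>n < D + 2\<close> leaves room for the odd modulus \<open>n + 1\<close>. If
  \<open>n = D + 2\<close> is even, the degree bound \<open>D = n - 2\<close> gives every vertex a
  non-neighbour, so the star construction applies.\<close>

lemma total_colorable_high_degree:
  assumes E: "E \<subseteq> nsets V 2" and fin: "finite V" and ne: "V \<noteq> {}"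
    and D: "\<And>v. v \<in> V \<Longrightarrow> degree E v \<le> D" and n: "card V \<le> D + 2"
  shows "total_colorable V E (D + 2)"
proof (cases "odd (card V)")
  case True
  show ?thesis
    by (rule total_colorable_mono[OF total_colorable_odd[OF E fin True order_refl] n])
next
  case even: False
  show ?thesis
  proof (cases "card V = D + 2")
    case False
    have "total_colorable V E (Suc (card V))"
      by (rule total_colorable_odd[OF E fin]) (use even in auto)
    then show ?thesis by (rule total_colorable_mono) (use n False in linarith)
  next
    case True
    have "\<exists>u\<in>V. v \<noteq> u \<and> {v, u} \<notin> E" if v: "v \<in> V" for v
    proof (rule ccontr)
      assume "\<not> (\<exists>u\<in>V. v \<noteq> u \<and> {v, u} \<notin> E)"
      then have "V - {v} \<subseteq> {u \<in> V. {v, u} \<in> E}" by auto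
      then have "card (V - {v}) \<le> degree E v"
        unfolding degree_eq_card_neighbours[OF E fin] using fin by (intro card_mono) auto
      then show False using D[OF v] True v fin by simp
    qed
    then show ?thesis using total_colorable_even[OF E fin _ ne] even True by simp
  qed
qed

lemma total_colorable_insert_isolated:
  fixes V :: "'a set"
  assumes E: "E \<subseteq> nsets V 2" and x: "x \<notin> V" and k: "0 < k" and tc: "total_colorable V E k"
  shows "total_colorable (insert x V) E k"
proof -
  obtain p :: "'a \<Rightarrow> nat" and q where pk: "\<And>y. y \<in> V \<Longrightarrow> p y < k"
    and q: "\<And>y z. {y, z} \<in> E \<Longrightarrow> q y z = q z y \<and> q y z < k \<and> p y \<noteq> p z \<and> p y \<noteq> q y z"
    and qz: "\<And>w y z. {w, y} \<in> E \<Longrightarrow> {w, z} \<in> E \<Longrightarrow> y \<noteq> z \<Longrightarrow> q w y \<noteq> q w z"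
    using tc unfolding total_colorable_def by blast
  have new: "y \<noteq> x \<and> z \<noteq> x" if "{y, z} \<in> E" for y z using edge_props[OF E that] x by auto
  show ?thesis
    unfolding total_colorable_def
  proof (intro exI[of _ "p(x := 0)"] exI[of _ q] conjI ballI allI impI)
    fix y z assume yz: "{y, z} \<in> E"
    show "q y z = q z y" "q y z < k" using q[OF yz] by blast+
    show "(p(x := 0)) y \<noteq> (p(x := 0)) z" "(p(x := 0)) y \<noteq> q y z" using q[OF yz] new[OF yz] by simp_all
  qed (use pk k qz in auto)
qed

text \<open>The new edge must avoid the color of \<open>u\<close> and those of the old edges at
  \<open>u\<close>, at most \<open>degree E u + 1 < k\<close> colors. Then \<open>x\<close> must
  avoid only two colors, that of \<open>u\<close> and that of the new edge.\<close>

lemma total_colorable_insert_pendant: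
  fixes V :: "'a set"
  assumes E: "E \<subseteq> nsets V 2" and fin: "finite V" and x: "x \<notin> V" and u: "u \<in> V"
    and deg: "degree E u + 1 < k" and k: "3 \<le> k" and tc: "total_colorable V E k"
  shows "total_colorable (insert x V) (insert {u, x} E) k"
proof -
  obtain p :: "'a \<Rightarrow> nat" and q where pk: "\<And>y. y \<in> V \<Longrightarrow> p y < k"
    and q: "\<And>y z. {y, z} \<in> E \<Longrightarrow> q y z = q z y \<and> q y z < k \<and> p y \<noteq> p z \<and> p y \<noteq> q y z"
    and qz: "\<And>w y z. {w, y} \<in> E \<Longrightarrow> {w, z} \<in> E \<Longrightarrow> y \<noteq> z \<Longrightarrow> q w y \<noteq> q w z"
    using tc unfolding total_colorable_def by blast
  have new: "y \<noteq> x \<and> z \<noteq> x" if "{y, z} \<in> E" for y z using edge_props[OF E that] x by auto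
  have free: "\<exists>a<k. a \<notin> A" if "finite A" "card A < k" for A
    using that card_mono[of A "{..<k}"] by (fastforce simp: subset_iff not_le)
  let ?N = "{w \<in> V. {u, w} \<in> E}"
  have finN: "finite ?N" using fin by simp
  have "card (insert (p u) (q u ` ?N)) \<le> Suc (card (q u ` ?N))"
    by (rule card_insert_le_m1) simp_all
  also have "\<dots> \<le> Suc (card ?N)" using card_image_le[OF finN] by simp
  also have "\<dots> < k" using deg by (simp add: degree_eq_card_neighbours[OF E fin])
  finally obtain a where a: "a < k" "a \<notin> insert (p u) (q u ` ?N)"
    using free[of "insert (p u) (q u ` ?N)"] finN by blast
  have "card {p u, a} < k" using k card_insert_le_m1[of 2 "{a}" "p u"] by simp
  then obtain b where b: "b < k" "b \<noteq> p u" "b \<noteq> a" using free[of "{p u, a}"] by auto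
  have au: "q u w \<noteq> a" if "{u, w} \<in> E" for w using a that edge_props(2)[OF E that] by blast
  have ux: "u \<noteq> x" using u x by blast
  define p' q' where "p' = p(x := b)" and "q' y z = (if y = x \<or> z = x then a else q y z)" for y z
  have edges: "{y, z} \<in> insert {u, x} E \<longleftrightarrow> (y = u \<and> z = x) \<or> (y = x \<and> z = u) \<or> {y, z} \<in> E" for y z
    by (auto simp: doubleton_eq_iff)
  show ?thesis
    unfolding total_colorable_def edges
  proof (intro exI[of _ p'] exI[of _ q'] conjI ballI allI impI)
    fix y z assume yz: "(y = u \<and> z = x) \<or> (y = x \<and> z = u) \<or> {y, z} \<in> E"
    show "q' y z = q' z y" "q' y z < k" using yz q[of y z] a by (auto simp: q'_def)
    show "p' y \<noteq> p' z" using yz q[of y z] new[of y z] b ux by (auto simp: p'_def)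
    show "p' y \<noteq> q' y z" using yz q[of y z] new[of y z] a b ux by (auto simp: p'_def q'_def)
    fix w assume yw: "(y = u \<and> w = x) \<or> (y = x \<and> w = u) \<or> {y, w} \<in> E" and "z \<noteq> w"
    then show "q' y z \<noteq> q' y w"
      using yz new[of y z] new[of y w] qz[of y z w] au[of z] au[of w] ux by (auto simp: q'_def)
  qed (use pk b in \<open>auto simp: p'_def\<close>)
qed

lemma finite_edges: "E \<subseteq> nsets V 2 \<Longrightarrow> finite V \<Longrightarrow> finite E"
  by (meson finite_imp_finite_nsets finite_subset)

section \<open>Induction along the mock threshold ordering\<close>

text \<open>\<open>D\<close> is a fixed degree bound, not the maximum degree of the current graph,
  so every stage works with the same number of colors. \<open>E\<close> varies because removing the
  last vertex removes its edges.\<close>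

lemma total_colorable_mock_threshold:
  fixes vs :: "'a list"
  assumes "distinct vs" "E \<subseteq> nsets (set vs) 2"
    and "\<And>i. i \<in> {1..length vs} \<Longrightarrow>
      degree (induced_edges E (set (take i vs))) (vs ! (i - 1)) \<in> {d. d = 0 \<or> d = 1 \<or> d + 2 = i \<or> d + 1 = i}"
    and "\<And>v. v \<in> set vs \<Longrightarrow> degree E v \<le> D"
  shows "total_colorable (set vs) E (D + 2)"
  using assms
proof (induction vs arbitrary: E rule: rev_induct)
  case Nil
  then have "E = {}" by (auto simp: nsets_def)
  then show ?case by (simp add: total_colorable_def)
next
  case (snoc x vs)
  let ?W = "set vs" and ?n = "Suc (length vs)"
  let ?V = "insert x ?W"
  have V: "set (vs @ [x]) = ?V" by simp
  have E: "E \<subseteq> nsets ?V 2" using snoc.prems(2) by simp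
  have x: "x \<notin> ?W" and dis: "distinct vs" using snoc.prems(1) by auto
  have fin: "finite ?V" "finite ?W" by simp_all
  have finE: "finite E" by (rule finite_edges[OF E fin(1)])
  have cV: "card ?V = ?n" using x distinct_card[OF dis] by simp
  have "induced_edges E ?V = E" using E by (auto simp: induced_edges_def nsets_def)
  then have d: "degree E x = 0 \<or> degree E x = 1 \<or> degree E x + 2 = ?n \<or> degree E x + 1 = ?n"
    using snoc.prems(3)[of ?n] by simp
  have dD: "degree E v \<le> D" if "v \<in> ?V" for v using snoc.prems(4) that by simp
  define E' where "E' = induced_edges E ?W"
  have E': "E' \<subseteq> nsets ?W 2" unfolding E'_def by (rule induced_edges_subset_nsets[OF E])
  have E'E: "e \<in> E' \<longleftrightarrow> e \<in> E \<and> x \<notin> e" for e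
    using E x by (auto simp: E'_def induced_edges_def nsets_def)
  have tc: "total_colorable ?W E' (D + 2)"
  proof (rule snoc.IH[OF dis E'])
    fix i assume i: "i \<in> {1..length vs}"
    then have "i - 1 < length vs" by auto
    then have idx: "(vs @ [x]) ! (i - 1) = vs ! (i - 1)" by (rule nth_append_left)
    have "set (take i vs) \<subseteq> ?W" by (rule set_take_subset)
    then have "induced_edges E' (set (take i vs)) = induced_edges E (set (take i vs))"
      by (auto simp: E'_def induced_edges_def)
    then show "degree (induced_edges E' (set (take i vs))) (vs ! (i - 1))
        \<in> {d. d = 0 \<or> d = 1 \<or> d + 2 = i \<or> d + 1 = i}"
      using snoc.prems(3)[of i] i idx by simp
  next
    fix v assume v: "v \<in> ?W"
    have "degree E' v \<le> degree E v"
      unfolding degree_def using finE E'E by (intro card_mono) auto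
    then show "degree E' v \<le> D" using dD[of v] v by simp
  qed
  \<comment> \<open>Both large degrees fall under the first case, where
    \<open>?n \<le> D + 2\<close> follows and the coloring from the induction hypothesis is
    discarded.\<close>
  consider "?n \<le> degree E x + 2" | "degree E x = 0" | "degree E x = 1" using d by linarith
  then have "total_colorable ?V E (D + 2)"
  proof cases
    case 1
    show ?thesis
    proof (rule total_colorable_high_degree[OF E fin(1)])
      show "card ?V \<le> D + 2" unfolding cV using 1 dD[of x] by simp
    qed (use dD in auto)
  next
    case 2
    then have "{e \<in> E. x \<in> e} = {}" using finE by (simp add: degree_def)
    then have "E = E'" using E'E by blast
    then show ?thesis using total_colorable_insert_isolated[OF E' x _ tc] by simp
  next
    case 3
    then obtain e where e: "{e \<in> E. x \<in> e} = {e}" by (auto simp: degree_def card_1_singleton_iff)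
    then have "e \<in> E" "x \<in> e" by blast+
    obtain y z where "e = {y, z}" using edge_obtain[OF E \<open>e \<in> E\<close>] .
    then obtain u where u: "e = {u, x}" using \<open>x \<in> e\<close> by auto
    have uW: "u \<in> ?W" using edge_props[OF E, of u x] \<open>e \<in> E\<close> u by auto
    have only: "f = e" if "f \<in> E" "x \<in> f" for f using e that by auto
    have EE': "E = insert {u, x} E'"
    proof (rule set_eqI)
      show "f \<in> E \<longleftrightarrow> f \<in> insert {u, x} E'" for f
        using E'E[of f] only[of f] \<open>e \<in> E\<close> u by auto
    qed
    have "e \<in> {f \<in> E. u \<in> f}" "e \<notin> {f \<in> E'. u \<in> f}" using \<open>e \<in> E\<close> E'E[of e] u by simp_all
    moreover have "{f \<in> E'. u \<in> f} \<subseteq> {f \<in> E. u \<in> f}" using E'E by auto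
    ultimately have "{f \<in> E'. u \<in> f} \<subset> {f \<in> E. u \<in> f}" by (metis psubsetI)
    then have "degree E' u < degree E u"
      unfolding degree_def using finE by (intro psubset_card_mono) auto
    \<comment> \<open>The pendant edge is counted at \<open>u\<close> only in \<open>E\<close>, so
      \<open>degree E' u + 1 \<le> D\<close>. As \<open>x\<close> has degree 1, \<open>D\<close> is
      positive and there are at least three colors.\<close>
    then show ?thesis
      using total_colorable_insert_pendant[OF E' fin(2) x uW _ _ tc] EE' dD[of u] dD[of x] 3 uW by simp
  qed
  then show ?case by simp
qed

section \<open>The lower bound and the conclusion\<close>

text \<open>A vertex and its incident edges receive pairwise distinct colors,
  \<open>degree E v + 1\<close> in number.\<close>

lemma degree_less_total_colors:
  fixes c :: "'a + 'a set \<Rightarrow> nat"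
  assumes "total_coloring V E c" "c ` (V <+> E) \<subseteq> {..<k}" "v \<in> V" "finite E"
  shows "degree E v < k"
proof -
  let ?S = "{e \<in> E. v \<in> e}"
  have inj: "inj_on (c \<circ> Inr) ?S"
  proof (rule inj_onI, rule ccontr)
    fix e f assume ef: "e \<in> ?S" "f \<in> ?S" "(c \<circ> Inr) e = (c \<circ> Inr) f" "e \<noteq> f"
    then have "e \<inter> f \<noteq> {}" by blast
    then show False using assms(1) ef unfolding total_coloring_def by simp
  qed
  have "c (Inl v) \<noteq> c (Inr e)" if "e \<in> ?S" for e
    using assms(1,3) that unfolding total_coloring_def by simp
  then have "c (Inl v) \<notin> (c \<circ> Inr) ` ?S" by (simp add: image_iff)
  then have "card (insert (c (Inl v)) ((c \<circ> Inr) ` ?S)) = Suc (degree E v)"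
    using assms(4) card_image[OF inj] by (simp add: degree_def)
  moreover have "insert (c (Inl v)) ((c \<circ> Inr) ` ?S) \<subseteq> {..<k}"
    using assms(2,3) by auto
  ultimately have "Suc (degree E v) \<le> k"
    using card_mono[OF finite_lessThan] by (metis card_lessThan)
  then show ?thesis by simp
qed

theorem theorem3p2:
  fixes V :: "'a set" and E :: "'a set set"
  assumes "simple_graph V E"
    and "V \<noteq> {}"
    and "mock_threshold V E"
  shows "total_chromatic_number V E \<in> {max_degree V E + 1, max_degree V E + 2}"
proof -
  let ?P = "\<lambda>k. \<exists>c :: 'a + 'a set \<Rightarrow> nat. total_coloring V E c \<and> c ` (V <+> E) \<subseteq> {..<k}"
  let ?D = "max_degree V E"
  have fin: "finite V" and E: "E \<subseteq> nsets V 2" using assms(1) by (auto simp: simple_graph_def)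
  obtain vs where vs: "distinct vs" "set vs = V"
    "\<And>i. i \<in> {1..length vs} \<Longrightarrow>
      degree (induced_edges E (set (take i vs))) (vs ! (i - 1)) \<in> {d. d = 0 \<or> d = 1 \<or> d + 2 = i \<or> d + 1 = i}"
    using assms(3) unfolding mock_threshold_def Let_def by blast
  have "degree E v \<le> ?D" if "v \<in> V" for v
    unfolding max_degree_def using that fin by (intro Max_ge) auto
  then have "total_colorable V E (?D + 2)"
    using total_colorable_mock_threshold[OF vs(1) _ vs(3), of ?D] E vs(2) by simp
  then have P: "?P (?D + 2)" by (rule total_colorable_imp_coloring[OF E])
  then have upper: "total_chromatic_number V E \<le> ?D + 2"
    unfolding total_chromatic_number_def by (rule Least_le)
  have "?P (total_chromatic_number V E)"
    unfolding total_chromatic_number_def using P by (rule LeastI)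
  then obtain c :: "'a + 'a set \<Rightarrow> nat" where c: "total_coloring V E c"
    "c ` (V <+> E) \<subseteq> {..<total_chromatic_number V E}" by blast
  \<comment> \<open>As \<open>V\<close> is nonempty and finite, some vertex attains the maximum
    degree; the lower bound is applied there to an optimal coloring.\<close>
  have "?D \<in> degree E ` V"
    unfolding max_degree_def using fin assms(2) by (intro Max_in) auto
  then have "?D < total_chromatic_number V E"
    using degree_less_total_colors[OF c _ finite_edges[OF E fin]] by auto
  then show ?thesis using upper by auto
qed

end
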